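(* Let $e^0\in\mathbb{R}^N$ be arbitrary and let $e^n\in\mathbb{R}^N$, $n=1,2,\ldots,L$, be generated by the recursion $$\left(\frac{h\Delta t^{-\alpha}}{\Gamma(2-\alpha)}I+A+B\right)e^n=\frac{h\Delta t^{-\alpha}}{\Gamma(2-\alpha)}\left(\sum_{k=1}^{n-1}(a_{n-k-1}-a_{n-k})e^k+a_{n-1}e^0\right)+hr^n,\qquad n=1,2,\ldots,L,$$ with $r^n=0$ for all $n=1,2,\ldots,L$. Then (for all grid parameters $N,L$, without any condition relating them) $$\|e^n\|_1\le\|e^0\|_1,\qquad n=1,2,\ldots,L.$$
   Context: Let $a<b$, $T>0$, $\alpha\in(0,1)$, $k_\alpha>0$ be real constants, and let $f:[a,b]\to\mathbb{R}$ be Lipschitz: $|f(x)-f(x')|\le C|x-x'|$ for all $x,x'\in[a,b]$. For positive integers $N,L$ put $h=(b-a)/(N+1)$, $x_i=a+ih$ ($i=0,\ldots,N+1$), $x_{i+\frac12}=a+(i+\frac12)h$ ($i=0,\ldots,N$), $\Delta t=T/L$. $\Gamma$ is the gamma function and $a_k=(k+1)^{1-\alpha}-k^{1-\alpha}$ for $k=0,1,2,\ldots$. Decompose $f=f^u+f^l+f^m$ with $f^u(x)=\max(f(x)-\frac{2k_\alpha}{h},0)$, $f^l(x)=\min(f(x)+\frac{2k_\alpha}{h},0)$, $f^m=f-f^u-f^l$. A subscript $i+\frac12$ denotes evaluation at $x_{i+\frac12}$, e.g. $f^m_{i+\frac12}=f^m(x_{i+\frac12})$. $I$ is the $N\times N$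 identity matrix. $A=(A_{ij})\in\mathbb{R}^{N\times N}$ is the tridiagonal matrix with $A_{jj}=\frac{2k_\alpha}{h}$ for $1\le j\le N$, $A_{j+1,j}=-\frac{k_\alpha}{h}$ for $1\le j\le N-1$, $A_{j-1,j}=-\frac{k_\alpha}{h}$ for $2\le j\le N$, all other entries $0$. $B=(B_{ij})\in\mathbb{R}^{N\times N}$ is the tridiagonal matrix with $B_{jj}=-\frac12f^m_{j-\frac12}+\frac12f^m_{j+\frac12}-f^l_{j-\frac12}+f^u_{j+\frac12}$ for $1\le j\le N$, $B_{j+1,j}=-\frac12f^m_{j+\frac12}-f^u_{j+\frac12}$ for $1\le j\le N-1$, $B_{j-1,j}=\frac12f^m_{j-\frac12}+f^l_{j-\frac12}$ for $2\le j\le N$, all other entries $0$. The discrete $L^1$ norm on $\mathbb{R}^N$ is $\|W\|_1=\sum_{i=1}^N h|W_i|$. *)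

theory Defs
  imports
    "HOL-Analysis.Gamma_Function"
    "HOL-Analysis.Lipschitz"
    "Jordan_Normal_Form.Matrix"
begin

text \<open>The coefficients \<open>a\<^sub>k\<close> of the L1 time discretization (unrelated to the \<open>L\<^sup>1\<close> norm
  below); the coefficient for \<open>k = 0\<close> is \<open>1\<close> since \<open>0 powr (1 - \<alpha>) = 0\<close>.\<close>
definition l1_weight :: "real \<Rightarrow> nat \<Rightarrow> real" where
  "l1_weight \<alpha> k = (real k + 1) powr (1 - \<alpha>) - real k powr (1 - \<alpha>)"

definition upper_part :: "real \<Rightarrow> real \<Rightarrow> (real \<Rightarrow> real) \<Rightarrow> real \<Rightarrow> real" where
  "upper_part k\<^sub>\<alpha> h f x = max (f x - 2 * k\<^sub>\<alpha> / h) 0"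

definition lower_part :: "real \<Rightarrow> real \<Rightarrow> (real \<Rightarrow> real) \<Rightarrow> real \<Rightarrow> real" where
  "lower_part k\<^sub>\<alpha> h f x = min (f x + 2 * k\<^sub>\<alpha> / h) 0"

definition middle_part :: "real \<Rightarrow> real \<Rightarrow> (real \<Rightarrow> real) \<Rightarrow> real \<Rightarrow> real" where
  "middle_part k\<^sub>\<alpha> h f x = f x - upper_part k\<^sub>\<alpha> h f x - lower_part k\<^sub>\<alpha> h f x"

text \<open>The index is real, so that the half-integer points \<open>x\<^sub>j\<^sub>-\<^sub>1\<^sub>/\<^sub>2\<close> and
  \<open>x\<^sub>j\<^sub>+\<^sub>1\<^sub>/\<^sub>2\<close> are \<open>grid_point a h (j - 1/2)\<close> and
  \<open>grid_point a h (j + 1/2)\<close>.\<close>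
definition grid_point :: "real \<Rightarrow> real \<Rightarrow> real \<Rightarrow> real" where
  "grid_point a h s = a + s * h"

text \<open>The two entry functions use row and column indices \<open>1, \<dots>, N\<close>. Library matrices are
  indexed from \<open>0\<close>, hence the shift by \<open>Suc\<close> in the two matrices.\<close>
definition A_entry :: "real \<Rightarrow> real \<Rightarrow> nat \<Rightarrow> nat \<Rightarrow> real" where
  "A_entry k\<^sub>\<alpha> h i j =
    (if i = j then 2 * k\<^sub>\<alpha> / h
     else if i = j + 1 then - k\<^sub>\<alpha> / h
     else if i + 1 = j then - k\<^sub>\<alpha> / h
     else 0)"

definition B_entry :: "real \<Rightarrow> real \<Rightarrow> real \<Rightarrow> (real \<Rightarrow> real) \<Rightarrow> nat \<Rightarrow> nat \<Rightarrow> real" where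
  "B_entry a k\<^sub>\<alpha> h f i j =
    (let xm = grid_point a h (real j - 1/2); xp = grid_point a h (real j + 1/2);
         fu = upper_part k\<^sub>\<alpha> h f; fl = lower_part k\<^sub>\<alpha> h f; fm = middle_part k\<^sub>\<alpha> h f
     in if i = j then - (1/2) * fm xm + (1/2) * fm xp - fl xm + fu xp
        else if i = j + 1 then - (1/2) * fm xp - fu xp
        else if i + 1 = j then (1/2) * fm xm + fl xm
        else 0)"

definition A_mat :: "nat \<Rightarrow> real \<Rightarrow> real \<Rightarrow> real mat" where
  "A_mat N k\<^sub>\<alpha> h = mat N N (\<lambda>(i, j). A_entry k\<^sub>\<alpha> h (Suc i) (Suc j))"

definition B_mat :: "nat \<Rightarrow> real \<Rightarrow> real \<Rightarrow> real \<Rightarrow> (real \<Rightarrow> real) \<Rightarrow> real mat" where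
  "B_mat N a k\<^sub>\<alpha> h f = mat N N (\<lambda>(i, j). B_entry a k\<^sub>\<alpha> h f (Suc i) (Suc j))"

definition disc_l1_norm :: "real \<Rightarrow> real vec \<Rightarrow> real" where
  "disc_l1_norm h W = (\<Sum>i<dim_vec W. h * \<bar>vec_index W i\<bar>)"

end

theory Submission
  imports Defs
begin

text \<open>The splitting of \<open>f\<close> keeps the middle part in \<open>[- 2 k\<^sub>\<alpha> / h, 2 k\<^sub>\<alpha> / h]\<close>, which makes
  \<open>A + B\<close> weakly diagonally dominant by columns with nonnegative diagonal. Testing the scheme
  against the signs of \<open>e\<^sup>n\<close> therefore discards \<open>A + B\<close>, and \<open>e\<^sup>n\<close> is bounded in the \<open>L\<^sup>1\<close> norm by the
  weighted history. Concavity of \<open>x powr (1 - \<alpha>)\<close> makes the weights nonnegative, and they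
  telescope to \<open>1\<close>, so induction on \<open>n\<close> concludes.\<close>

lemma l1_weight_0 [simp]: "l1_weight \<alpha> 0 = 1"
  by (simp add: l1_weight_def)

lemma l1_weight_nonneg: "\<alpha> < 1 \<Longrightarrow> 0 \<le> l1_weight \<alpha> k"
  by (simp add: l1_weight_def powr_mono2)

text \<open>The case \<open>x = 0\<close> is allowed although the power need not be differentiable
  there: the mean value theorem asks for continuity at the endpoints, which \<open>0 < p\<close>
  gives, and for a derivative only at points strictly above \<open>x\<close>.\<close>

lemma powr_increment_mean_value:
  fixes x p :: real
  assumes "0 \<le> x" "0 < p"
  obtains z where "x < z" "z < x + 1" "(x + 1) powr p - x powr p = p * z powr (p - 1)"
proof -
  have cont: "continuous_on {x..x + 1} (\<lambda>t. t powr p)"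
    using assms by (intro continuous_on_powr') auto
  have deriv: "((\<lambda>t. t powr p) has_real_derivative p * t powr (p - 1)) (at t)" if "x < t" for t
    using that assms by (intro has_real_derivative_powr) auto
  have "\<exists>l z. x < z \<and> z < x + 1 \<and> ((\<lambda>t. t powr p) has_real_derivative l) (at z) \<and>
      (x + 1) powr p - x powr p = (x + 1 - x) * l"
    using cont deriv by (intro MVT) (auto simp: real_differentiable_def)
  then show ?thesis using that deriv DERIV_unique by fastforce
qed

text \<open>Consecutive weights are increments over adjacent unit intervals, so their mean value
  points satisfy \<open>y < k + 1 < z\<close>, and \<open>t powr (- \<alpha>)\<close> decreases for
  positive \<open>t\<close>.\<close>

lemma l1_weight_antimono:
  assumes "0 < \<alpha>" "\<alpha> < 1"
  shows "l1_weight \<alpha> (Suc k) \<le> l1_weight \<alpha> k"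
proof -
  obtain y where y: "real k < y" "y < real k + 1"
      "l1_weight \<alpha> k = (1 - \<alpha>) * y powr (- \<alpha>)"
    using powr_increment_mean_value[of "real k" "1 - \<alpha>"] assms
    by (auto simp: l1_weight_def)
  obtain z where z: "real (Suc k) < z"
      "l1_weight \<alpha> (Suc k) = (1 - \<alpha>) * z powr (- \<alpha>)"
    using powr_increment_mean_value[of "real (Suc k)" "1 - \<alpha>"] assms
    by (auto simp: l1_weight_def)
  have "z powr (- \<alpha>) \<le> y powr (- \<alpha>)"
    using y z assms by (intro powr_mono2') auto
  then show ?thesis using y z assms by (simp add: mult_left_mono)
qed

lemma sum_l1_weight_diff:
  assumes "1 \<le> n"
  shows "(\<Sum>k=1..n-1. l1_weight \<alpha> (n - k - 1) - l1_weight \<alpha> (n - k)) + l1_weight \<alpha> (n - 1) = 1"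
proof -
  \<comment> \<open>With \<open>n - k - 1 = n - Suc k\<close> the sum telescopes to
    \<open>l1_weight \<alpha> 1\<close> minus nothing but boundary terms: the weight at index 0,
    which is 1, minus the weight at \<open>n - 1\<close>.\<close>
  have "(\<Sum>k=1..n-1. l1_weight \<alpha> (n - k - 1) - l1_weight \<alpha> (n - k))
      = (\<Sum>k=Suc 0..n-1. (\<lambda>k. l1_weight \<alpha> (n - k)) (Suc k) - (\<lambda>k. l1_weight \<alpha> (n - k)) k)"
    by (intro sum.cong) auto
  also have "\<dots> = l1_weight \<alpha> (n - Suc (n - 1)) - l1_weight \<alpha> (n - Suc 0)"
    using assms by (subst sum_Suc_diff) auto
  finally show ?thesis using assms by simp
qed

text \<open>The middle part is \<open>f\<close> clamped at the two thresholds; as these have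
  opposite signs, at most one of the two cut-offs is active at any point.\<close>

lemma middle_part_bounds:
  assumes "0 < k\<^sub>\<alpha>" "0 < h"
  shows "- 2 * k\<^sub>\<alpha> / h \<le> middle_part k\<^sub>\<alpha> h f x" "middle_part k\<^sub>\<alpha> h f x \<le> 2 * k\<^sub>\<alpha> / h"
proof -
  have "0 < k\<^sub>\<alpha> / h" using assms by simp
  then show "- 2 * k\<^sub>\<alpha> / h \<le> middle_part k\<^sub>\<alpha> h f x" "middle_part k\<^sub>\<alpha> h f x \<le> 2 * k\<^sub>\<alpha> / h"
    by (auto simp: middle_part_def upper_part_def lower_part_def max_def min_def)
qed

lemma A_B_column_dominant:
  fixes a :: real and f :: "real \<Rightarrow> real"
  assumes "0 < k\<^sub>\<alpha>" "0 < h"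
  defines "M \<equiv> \<lambda>i j. A_entry k\<^sub>\<alpha> h (Suc i) (Suc j) + B_entry a k\<^sub>\<alpha> h f (Suc i) (Suc j)"
  shows "(\<Sum>i\<in>{..<N} - {j}. \<bar>M i j\<bar>) \<le> M j j"
proof -
  define xm where "xm = grid_point a h (real (Suc j) - 1/2)"
  define xp where "xp = grid_point a h (real (Suc j) + 1/2)"
  \<comment> \<open>\<open>- p\<close> and \<open>- q\<close> are the entries of column
    \<open>j\<close> just below and just above the diagonal. The bounds on the middle part keep its
    half within \<open>k\<^sub>\<alpha> / h\<close>, and the upper and lower parts enter with a
    favourable sign.\<close>
  define p where "p = k\<^sub>\<alpha> / h + middle_part k\<^sub>\<alpha> h f xp / 2 + upper_part k\<^sub>\<alpha> h f xp"
  define q where "q = k\<^sub>\<alpha> / h - middle_part k\<^sub>\<alpha> h f xm / 2 - lower_part k\<^sub>\<alpha> h f xm"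
  have "0 \<le> p"
    using middle_part_bounds(1)[OF assms(1,2), of f xp] by (simp add: p_def upper_part_def)
  have "lower_part k\<^sub>\<alpha> h f xm \<le> 0" by (simp add: lower_part_def)
  then have "0 \<le> q"
    using middle_part_bounds(2)[OF assms(1,2), of f xm] by (simp add: q_def)
  \<comment> \<open>For \<open>j = 0\<close> the index \<open>j - 1\<close> truncates to
    \<open>j\<close> itself, which the sum omits, so no spurious \<open>q\<close> is counted. The
    first and last columns lack a neighbour, hence an inequality with \<open>p + q\<close>.\<close>
  have "(\<Sum>i\<in>{..<N} - {j}. \<bar>M i j\<bar>)
      \<le> (\<Sum>i\<in>{..<N} - {j}. (if i = Suc j then p else 0) + (if i = j - 1 then q else 0))"
  proof (rule sum_mono)
    fix i assume "i \<in> {..<N} - {j}"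
    then consider "i = Suc j" | "Suc i = j" | "i \<noteq> j" "i \<noteq> Suc j" "Suc i \<noteq> j" by auto
    then show "\<bar>M i j\<bar> \<le> (if i = Suc j then p else 0) + (if i = j - 1 then q else 0)"
    proof cases
      case 1
      then have "M i j = - p"
        by (simp add: M_def A_entry_def B_entry_def Let_def p_def xp_def)
      then show ?thesis using 1 \<open>0 \<le> p\<close> by simp
    next
      case 2
      then have "M i j = - q"
        by (auto simp: M_def A_entry_def B_entry_def Let_def q_def xm_def)
      then show ?thesis using 2 \<open>0 \<le> q\<close> by auto
    next
      case 3
      then have "M i j = 0" by (simp add: M_def A_entry_def B_entry_def Let_def)
      then show ?thesis using \<open>0 \<le> p\<close> \<open>0 \<le> q\<close> by simp
    qed
  qed
  also have "\<dots> \<le> p + q"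
    using \<open>0 \<le> p\<close> \<open>0 \<le> q\<close> by (simp add: sum.distrib sum.delta)
  also have "p + q = M j j"
    by (simp add: M_def A_entry_def B_entry_def Let_def p_def q_def xm_def xp_def)
  finally show ?thesis .
qed

text \<open>Multiply row \<open>i\<close> by \<open>sgn (x i)\<close> and sum over the rows: the
  first term becomes \<open>c\<close> times the sum of the \<open>\<bar>x i\<bar>\<close>, the
  matrix term is nonnegative, and the right side is at most the sum of the
  \<open>\<bar>g i\<bar>\<close>.\<close>

lemma column_dominant_l1_bound:
  fixes M :: "nat \<Rightarrow> nat \<Rightarrow> real" and x g :: "nat \<Rightarrow> real"
  assumes dom: "\<And>j. j < N \<Longrightarrow> (\<Sum>i\<in>{..<N} - {j}. \<bar>M i j\<bar>) \<le> M j j"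
    and eq: "\<And>i. i < N \<Longrightarrow> c * x i + (\<Sum>j<N. M i j * x j) = g i"
  shows "c * (\<Sum>i<N. \<bar>x i\<bar>) \<le> (\<Sum>i<N. \<bar>g i\<bar>)"
proof -
  \<comment> \<open>Column \<open>j\<close> contributes at least \<open>\<bar>x j\<bar>\<close>
    times the diagonal entry minus the absolute off-diagonal sum, which dominance makes
    nonnegative.\<close>
  have col: "0 \<le> (\<Sum>i<N. sgn (x i) * (M i j * x j))" if "j < N" for j
  proof -
    have "(\<Sum>i<N. sgn (x i) * (M i j * x j))
        = M j j * \<bar>x j\<bar> + (\<Sum>i\<in>{..<N} - {j}. sgn (x i) * (M i j * x j))"
      using that by (subst sum.remove[of _ j]) (auto simp: abs_sgn mult_ac)
    moreover have "- (\<bar>M i j\<bar> * \<bar>x j\<bar>) \<le> sgn (x i) * (M i j * x j)" for i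
    proof -
      have "\<bar>sgn (x i) * (M i j * x j)\<bar> \<le> \<bar>M i j\<bar> * \<bar>x j\<bar>"
        by (simp add: abs_mult abs_sgn_eq)
      then show ?thesis by linarith
    qed
    then have "(\<Sum>i\<in>{..<N} - {j}. - (\<bar>M i j\<bar> * \<bar>x j\<bar>))
        \<le> (\<Sum>i\<in>{..<N} - {j}. sgn (x i) * (M i j * x j))"
      by (intro sum_mono)
    moreover have "(\<Sum>i\<in>{..<N} - {j}. \<bar>M i j\<bar>) * \<bar>x j\<bar> \<le> M j j * \<bar>x j\<bar>"
      using dom[OF that] by (rule mult_right_mono) simp
    ultimately show ?thesis by (simp add: sum_negf sum_distrib_right)
  qed
  have "0 \<le> (\<Sum>j<N. \<Sum>i<N. sgn (x i) * (M i j * x j))"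
    by (rule sum_nonneg) (simp add: col)
  then have M: "0 \<le> (\<Sum>i<N. sgn (x i) * (\<Sum>j<N. M i j * x j))"
    by (subst (asm) sum.swap) (simp add: sum_distrib_left)
  have "c * (\<Sum>i<N. \<bar>x i\<bar>) + (\<Sum>i<N. sgn (x i) * (\<Sum>j<N. M i j * x j))
      = (\<Sum>i<N. sgn (x i) * (c * x i + (\<Sum>j<N. M i j * x j)))"
    by (simp add: sum_distrib_left sum.distrib algebra_simps abs_sgn)
  also have "\<dots> = (\<Sum>i<N. sgn (x i) * g i)"
    by (simp add: eq)
  also have "\<dots> \<le> (\<Sum>i<N. \<bar>g i\<bar>)"
  proof (rule sum_mono)
    fix i
    show "sgn (x i) * g i \<le> \<bar>g i\<bar>" by (cases "x i" "0::real" rule: linorder_cases) auto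
  qed
  finally show ?thesis using M by simp
qed

theorem theorem3p1:
  fixes a b T \<alpha> k\<^sub>\<alpha> C h \<Delta>t :: real
    and f :: "real \<Rightarrow> real"
    and N L n :: nat
    and e r :: "nat \<Rightarrow> real vec"
  assumes "a < b" and "0 < T" and "0 < \<alpha>" and "\<alpha> < 1" and "0 < k\<^sub>\<alpha>"
    and "C-lipschitz_on {a..b} f"
    and "0 < N" and "0 < L"
    and "h = (b - a) / (real N + 1)" and "\<Delta>t = T / real L"
    and "\<And>n. n \<le> L \<Longrightarrow> e n \<in> carrier_vec N"
    and "\<And>n. 1 \<le> n \<Longrightarrow> n \<le> L \<Longrightarrow> r n = 0\<^sub>v N"
    and "\<And>n. 1 \<le> n \<Longrightarrow> n \<le> L \<Longrightarrow>
      ((h * \<Delta>t powr (- \<alpha>) / Gamma (2 - \<alpha>)) \<cdot>\<^sub>m 1\<^sub>m N + A_mat N k\<^sub>\<alpha> h + B_mat N a k\<^sub>\<alpha> h f) *\<^sub>v e n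
      = (h * \<Delta>t powr (- \<alpha>) / Gamma (2 - \<alpha>)) \<cdot>\<^sub>v
          (finsum_vec TYPE(real) N
             (\<lambda>k. (l1_weight \<alpha> (n - k - 1) - l1_weight \<alpha> (n - k)) \<cdot>\<^sub>v e k) {1..n-1}
           + l1_weight \<alpha> (n - 1) \<cdot>\<^sub>v e 0)
        + h \<cdot>\<^sub>v r n"
    and "1 \<le> n" and "n \<le> L"
  shows "disc_l1_norm h (e n) \<le> disc_l1_norm h (e 0)"
proof -
  define c where "c = h * \<Delta>t powr (- \<alpha>) / Gamma (2 - \<alpha>)"
  have "0 < h" using assms(1,9) by simp
  have "0 < \<Delta>t" using assms(2,8,10) by simp
  have "0 < c"
    using \<open>0 < h\<close> \<open>0 < \<Delta>t\<close> assms(4) by (simp add: c_def Gamma_real_pos)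
  define w where "w = (\<lambda>n k. l1_weight \<alpha> (n - k - 1) - l1_weight \<alpha> (n - k))"
  define M where "M = (\<lambda>i j. A_entry k\<^sub>\<alpha> h (Suc i) (Suc j) + B_entry a k\<^sub>\<alpha> h f (Suc i) (Suc j))"
  \<comment> \<open>The norm without its constant factor \<open>h\<close>, which is restored only at
    the end.\<close>
  define S where "S = (\<lambda>n. \<Sum>i<N. \<bar>e n $ i\<bar>)"
  have dim: "dim_vec (e k) = N" if "k \<le> L" for k
    using assms(11)[OF that] by simp
  have w_nonneg: "0 \<le> w n k" if "k \<in> {1..n-1}" for n k
  proof -
    have "n - k = Suc (n - k - 1)" using that by auto
    then show ?thesis
      unfolding w_def using l1_weight_antimono[OF assms(3,4), of "n - k - 1"] by simp
  qed
  \<comment> \<open>The recursion read off in coordinate \<open>i\<close>; the residual vanishes and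
    the identity matrix leaves \<open>c * e n $ i\<close>.\<close>
  have component: "c * e n $ i + (\<Sum>j<N. M i j * e n $ j)
      = c * ((\<Sum>k=1..n-1. w n k * e k $ i) + l1_weight \<alpha> (n - 1) * e 0 $ i)"
    if n: "1 \<le> n" "n \<le> L" and i: "i < N" for n i
  proof -
    have en: "e n \<in> carrier_vec N" and e0: "e 0 \<in> carrier_vec N"
      and ek: "(\<lambda>k. w n k \<cdot>\<^sub>v e k) \<in> {1..n-1} \<rightarrow> carrier_vec N"
      using assms(11) n by auto
    have fin: "finsum_vec TYPE(real) N (\<lambda>k. w n k \<cdot>\<^sub>v e k) {1..n-1} \<in> carrier_vec N"
      by (rule finsum_vec_closed[OF ek])
    have "((c \<cdot>\<^sub>m 1\<^sub>m N + A_mat N k\<^sub>\<alpha> h + B_mat N a k\<^sub>\<alpha> h f) *\<^sub>v e n) $ i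
        = (c \<cdot>\<^sub>v (finsum_vec TYPE(real) N (\<lambda>k. w n k \<cdot>\<^sub>v e k) {1..n-1}
             + l1_weight \<alpha> (n - 1) \<cdot>\<^sub>v e 0) + h \<cdot>\<^sub>v r n) $ i"
      using assms(13)[OF n] by (simp only: c_def w_def)
    also have "\<dots> = c * ((\<Sum>k=1..n-1. (w n k \<cdot>\<^sub>v e k) $ i) + l1_weight \<alpha> (n - 1) * e 0 $ i)"
      using i e0 fin by (simp add: assms(12)[OF n] index_finsum_vec[OF _ i ek] del: One_nat_def)
    also have "(\<Sum>k=1..n-1. (w n k \<cdot>\<^sub>v e k) $ i) = (\<Sum>k=1..n-1. w n k * e k $ i)"
      using dim n i by (intro sum.cong) auto
    finally have rhs: "((c \<cdot>\<^sub>m 1\<^sub>m N + A_mat N k\<^sub>\<alpha> h + B_mat N a k\<^sub>\<alpha> h f) *\<^sub>v e n) $ i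
        = c * ((\<Sum>k=1..n-1. w n k * e k $ i) + l1_weight \<alpha> (n - 1) * e 0 $ i)" .
    have "((c \<cdot>\<^sub>m 1\<^sub>m N + A_mat N k\<^sub>\<alpha> h + B_mat N a k\<^sub>\<alpha> h f) *\<^sub>v e n) $ i
        = (\<Sum>j<N. ((if i = j then c else 0) + M i j) * e n $ j)"
      using i en by (auto simp: A_mat_def B_mat_def M_def scalar_prod_def lessThan_atLeast0
          intro!: sum.cong)
    also have "\<dots> = (\<Sum>j<N. if j = i then c * e n $ j else 0) + (\<Sum>j<N. M i j * e n $ j)"
      by (subst sum.distrib[symmetric]) (auto intro!: sum.cong simp: algebra_simps)
    also have "\<dots> = c * e n $ i + (\<Sum>j<N. M i j * e n $ j)"
      using i by simp
    finally show ?thesis using rhs by simp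
  qed
  \<comment> \<open>Dominance discards the matrix, the triangle inequality with nonnegative weights
    bounds the history, and the positive factor \<open>c\<close> cancels.\<close>
  have step: "S n \<le> (\<Sum>k=1..n-1. w n k * S k) + l1_weight \<alpha> (n - 1) * S 0"
    if n: "1 \<le> n" "n \<le> L" for n
  proof -
    have "c * S n \<le>
      (\<Sum>i<N. \<bar>c * ((\<Sum>k=1..n-1. w n k * e k $ i) + l1_weight \<alpha> (n - 1) * e 0 $ i)\<bar>)"
      unfolding S_def
    proof (rule column_dominant_l1_bound)
      show "(\<Sum>i\<in>{..<N} - {j}. \<bar>M i j\<bar>) \<le> M j j" for j
        unfolding M_def by (rule A_B_column_dominant[OF assms(5) \<open>0 < h\<close>])
    qed (rule component[OF n])
    also have "\<dots> \<le>
      (\<Sum>i<N. c * ((\<Sum>k=1..n-1. w n k * \<bar>e k $ i\<bar>) + l1_weight \<alpha> (n - 1) * \<bar>e 0 $ i\<bar>))"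
    proof (rule sum_mono)
      fix i
      have "\<bar>\<Sum>k=1..n-1. w n k * e k $ i\<bar> \<le> (\<Sum>k=1..n-1. w n k * \<bar>e k $ i\<bar>)"
        by (rule order.trans[OF sum_abs]) (auto intro!: sum_mono simp: abs_mult w_nonneg)
      moreover have "\<bar>l1_weight \<alpha> (n - 1) * e 0 $ i\<bar> = l1_weight \<alpha> (n - 1) * \<bar>e 0 $ i\<bar>"
        using l1_weight_nonneg[OF assms(4)] by (simp add: abs_mult)
      ultimately have "\<bar>(\<Sum>k=1..n-1. w n k * e k $ i) + l1_weight \<alpha> (n - 1) * e 0 $ i\<bar>
          \<le> (\<Sum>k=1..n-1. w n k * \<bar>e k $ i\<bar>) + l1_weight \<alpha> (n - 1) * \<bar>e 0 $ i\<bar>"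
        by linarith
      then show "\<bar>c * ((\<Sum>k=1..n-1. w n k * e k $ i) + l1_weight \<alpha> (n - 1) * e 0 $ i)\<bar>
          \<le> c * ((\<Sum>k=1..n-1. w n k * \<bar>e k $ i\<bar>) + l1_weight \<alpha> (n - 1) * \<bar>e 0 $ i\<bar>)"
        using \<open>0 < c\<close> by (simp add: abs_mult)
    qed
    also have "\<dots> = c * ((\<Sum>i<N. \<Sum>k=1..n-1. w n k * \<bar>e k $ i\<bar>) + l1_weight \<alpha> (n - 1) * S 0)"
      by (simp only: S_def sum_distrib_left[symmetric] sum.distrib)
    also have "(\<Sum>i<N. \<Sum>k=1..n-1. w n k * \<bar>e k $ i\<bar>) = (\<Sum>k=1..n-1. w n k * S k)"
      unfolding S_def sum_distrib_left by (rule sum.swap)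
    finally show ?thesis using \<open>0 < c\<close> by simp
  qed
  \<comment> \<open>Strong induction, since the memory term involves every earlier time level. The
    right side of \<open>step\<close> is a convex combination of values already bounded by
    \<open>S 0\<close>.\<close>
  have bound: "S n \<le> S 0" if "n \<le> L" for n
    using that
  proof (induction n rule: less_induct)
    case (less n)
    show ?case
    proof (cases "n = 0")
      case False
      then have n: "1 \<le> n" by simp
      have "S n \<le> (\<Sum>k=1..n-1. w n k * S k) + l1_weight \<alpha> (n - 1) * S 0"
        using step[OF n less.prems] .
      also have "(\<Sum>k=1..n-1. w n k * S k) \<le> (\<Sum>k=1..n-1. w n k * S 0)"
        using less by (intro sum_mono mult_left_mono w_nonneg) auto
      also have "\<dots> + l1_weight \<alpha> (n - 1) * S 0
          = ((\<Sum>k=1..n-1. w n k) + l1_weight \<alpha> (n - 1)) * S 0"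
        by (simp only: sum_distrib_right distrib_right)
      also have "\<dots> = S 0"
        unfolding w_def using sum_l1_weight_diff[OF n, of \<alpha>] by simp
      finally show ?thesis by simp
    qed simp
  qed
  have "disc_l1_norm h (e m) = h * S m" if "m \<le> L" for m
    using dim[OF that] by (simp add: disc_l1_norm_def S_def sum_distrib_left)
  then show ?thesis
    using bound[OF assms(15)] assms(15) \<open>0 < h\<close> by simp
qed

end
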